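(* Let $\mathcal{H}=(C,F,D,G)$ be a hybrid system on $\mathbb{R}^n$ such that $F$ is outer semicontinuous and locally bounded with nonempty and convex images, and $G(x)\neq\emptyset$ for all $x\in D$. Let $B=(B_1,\dots,B_m):\mathbb{R}^n\to\mathbb{R}^m$ be a continuously differentiable barrier function candidate defining the set $K=\{x\in C\cup D: B(x)\le 0\}$, and assume $K$ is closed. For each $i\in\{1,\dots,m\}$ let $K_{ei}:=\{x\in\mathbb{R}^n: B_i(x)\le 0\}$ and $M_i:=\{x\in\partial K: B_i(x)=0\}$. Suppose that for each $i\in\{1,\dots,m\}$ there exists an open neighborhood $U(M_i)$ of $M_i$ such that $$\langle \nabla B_i(x),\eta\rangle\le 0\quad \forall x\in (U(M_i)\setminus K_{ei})\cap C,\ \forall \eta\in F(x)\cap T_C(x),$$ and that $$B(\eta)\le 0\quad \forall \eta\in G(x),\ \forall x\in D\cap K,\qquad\text{and}\qquad G(x)\subset C\cup D\quad\forall x\in D\cap K.$$ Then $K$ is forward pre-invariant for $\mathcal{H}$.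
   Context: A hybrid system $\mathcal{H}=(C,F,D,G)$ consists of sets $C,D\subset\mathbb{R}^n$ and set-valued maps $F,G:\mathbb{R}^n\rightrightarrows\mathbb{R}^n$, and represents $\dot x\in F(x)$ for $x\in C$ and $x^+\in G(x)$ for $x\in D$. A hybrid time domain is a set $E\subset\mathbb{R}_{\ge0}\times\mathbb{N}$ such that for each $(T,J)\in E$, $E\cap([0,T]\times\{0,\dots,J\})=\bigcup_{j=0}^J([t_j,t_{j+1}]\times\{j\})$ for some $0=t_0\le t_1\le\dots\le t_{J+1}$. A solution $x$ to $\mathcal{H}$ is a function $x:\operatorname{dom}x\to\mathbb{R}^n$ on a hybrid time domain $\operatorname{dom}x$, with $t\mapsto x(t,j)$ locally absolutely continuous on $I^j:=\{t:(t,j)\in\operatorname{dom}x\}$ for each $j$, such that: $x(0,0)\in\mathrm{cl}(C)\cup D$; for every $j$ for which $I^j$ has nonempty interior, $x(t,j)\in C$ for all $t\in\mathrm{int}(I^j)$ and $\dot x(t,j)\in F(x(t,j))$ for almost all $t\in I^j$; and for all $(t,j)\in\operatorname{dom}x$ with $(t,j+1)\in\operatorname{dom}x$, $x(t,j)\in D$ and $x(t,j+1)\in G(x(t,j))$. It starts from $x_o$ if $x(0,0)=x_o$. It is maximal if there is no solution $y$ with $\operatorname{dom}x$ a proper subset of $\operatorname{dom}y$ and $y=x$ on $\operatorname{dom}x$. A set $K\subset C\cup D$ is forward pre-invariant for $\mathcal{H}$ if for each $x_o\in K$ and each maximal solution $x$ starting from $x_o$, $x(t,j)\in K$ for all $(t,j)\in\operatorname{dom}x$.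 $B:\mathbb{R}^n\to\mathbb{R}^m$ is a barrier function candidate defining $K$ if $K=\{x\in C\cup D:B(x)\le0\}$; vector inequalities are componentwise. The contingent cone of a set $S$ at $x$ is $T_S(x)=\{v:\liminf_{h\to0^+}|x+hv|_S/h=0\}$, where $|z|_S=\inf_{y\in S}|z-y|$. $\partial S$ denotes the boundary of $S$. *)

theory Defs
  imports "HOL-Analysis.Analysis"
begin

definition outer_semicontinuous :: "('a::metric_space \<Rightarrow> 'b::metric_space set) \<Rightarrow> bool" where
  "outer_semicontinuous F \<longleftrightarrow>
     (\<forall>x y X Y. X \<longlonglongrightarrow> x \<and> Y \<longlonglongrightarrow> y \<and> (\<forall>k::nat. Y k \<in> F (X k)) \<longrightarrow> y \<in> F x)"

definition locally_bounded_map :: "('a::metric_space \<Rightarrow> 'b::metric_space set) \<Rightarrow> bool" where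
  "locally_bounded_map F \<longleftrightarrow> (\<forall>x. \<exists>U. open U \<and> x \<in> U \<and> bounded (\<Union>y\<in>U. F y))"

definition continuously_differentiable ::
    "('a::real_normed_vector \<Rightarrow> 'b::real_normed_vector) \<Rightarrow> bool" where
  "continuously_differentiable f \<longleftrightarrow>
     (\<exists>f' :: 'a \<Rightarrow> 'a \<Rightarrow>\<^sub>L 'b.
        (\<forall>x. (f has_derivative blinfun_apply (f' x)) (at x)) \<and> continuous_on UNIV f')"

definition gradient :: "('a::real_inner \<Rightarrow> real) \<Rightarrow> 'a \<Rightarrow> 'a" where
  "gradient f x = (THE d. GDERIV f x :> d)"

text \<open>
  The library's \<open>infdist\<close> is 0 for the empty set, where the infimum over the empty set
  should be \<open>\<infinity>\<close>; the first conjunct makes the cone of the empty set empty.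
\<close>
definition contingent_cone :: "'a::real_normed_vector set \<Rightarrow> 'a \<Rightarrow> 'a set" where
  "contingent_cone S x =
     {v. S \<noteq> {} \<and> Liminf (at_right 0) (\<lambda>h. ereal (infdist (x + h *\<^sub>R v) S / h)) = 0}"

text \<open>
  A pair \<open>(u, v)\<close> stands for the open interval from \<open>u\<close> to \<open>v\<close>.
\<close>
definition absolutely_continuous_on_interval ::
    "real \<Rightarrow> real \<Rightarrow> (real \<Rightarrow> 'a::real_normed_vector) \<Rightarrow> bool" where
  "absolutely_continuous_on_interval a b f \<longleftrightarrow>
     (\<forall>\<epsilon>>0. \<exists>\<delta>>0. \<forall>P :: (real \<times> real) set.
        finite P \<and> (\<forall>(u, v)\<in>P. a \<le> u \<and> u \<le> v \<and> v \<le> b) \<and>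
        pairwise (\<lambda>p q. {fst p<..<snd p} \<inter> {fst q<..<snd q} = {}) P \<and>
        (\<Sum>(u, v)\<in>P. v - u) < \<delta> \<longrightarrow>
        (\<Sum>(u, v)\<in>P. norm (f v - f u)) < \<epsilon>)"

definition locally_absolutely_continuous_on ::
    "real set \<Rightarrow> (real \<Rightarrow> 'a::real_normed_vector) \<Rightarrow> bool" where
  "locally_absolutely_continuous_on I f \<longleftrightarrow>
     (\<forall>a b. a \<le> b \<and> {a..b} \<subseteq> I \<longrightarrow> absolutely_continuous_on_interval a b f)"

definition hybrid_time_domain :: "(real \<times> nat) set \<Rightarrow> bool" where
  "hybrid_time_domain E \<longleftrightarrow>
     E \<subseteq> {0..} \<times> UNIV \<and>
     (\<forall>(T, J)\<in>E. \<exists>t :: nat \<Rightarrow> real. t 0 = 0 \<and> (\<forall>j\<le>J. t j \<le> t (Suc j)) \<and>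
        E \<inter> ({0..T} \<times> {0..J}) = (\<Union>j\<in>{0..J}. {t j..t (Suc j)} \<times> {j}))"

definition flow_times :: "(real \<times> nat) set \<Rightarrow> nat \<Rightarrow> real set" where
  "flow_times E j = {t. (t, j) \<in> E}"

text \<open>
  A hybrid arc is a pair of a domain \<open>E\<close> and a total function \<open>x\<close> whose values
  outside \<open>E\<close> are irrelevant; hence the derivative is taken within \<open>flow_times E j\<close>.
  That \<open>E\<close> contains \<open>(0, 0)\<close> is implicit in the condition on \<open>x 0 0\<close>.
\<close>
definition hybrid_solution ::
    "'a::euclidean_space set \<Rightarrow> ('a \<Rightarrow> 'a set) \<Rightarrow> 'a set \<Rightarrow> ('a \<Rightarrow> 'a set) \<Rightarrow>
     (real \<times> nat) set \<Rightarrow> (real \<Rightarrow> nat \<Rightarrow> 'a) \<Rightarrow> bool" where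
  "hybrid_solution C F D G E x \<longleftrightarrow>
     hybrid_time_domain E \<and>
     (\<forall>j. locally_absolutely_continuous_on (flow_times E j) (\<lambda>t. x t j)) \<and>
     (0, 0) \<in> E \<and> x 0 0 \<in> closure C \<union> D \<and>
     (\<forall>j. interior (flow_times E j) \<noteq> {} \<longrightarrow>
        (\<forall>t\<in>interior (flow_times E j). x t j \<in> C) \<and>
        (AE t in lebesgue. t \<in> flow_times E j \<longrightarrow>
           (\<exists>v\<in>F (x t j).
              ((\<lambda>s. x s j) has_vector_derivative v) (at t within flow_times E j)))) \<and>
     (\<forall>t j. (t, j) \<in> E \<and> (t, Suc j) \<in> E \<longrightarrow> x t j \<in> D \<and> x t (Suc j) \<in> G (x t j))"

definition maximal_hybrid_solution ::
    "'a::euclidean_space set \<Rightarrow> ('a \<Rightarrow> 'a set) \<Rightarrow> 'a set \<Rightarrow> ('a \<Rightarrow> 'a set) \<Rightarrow>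
     (real \<times> nat) set \<Rightarrow> (real \<Rightarrow> nat \<Rightarrow> 'a) \<Rightarrow> bool" where
  "maximal_hybrid_solution C F D G E x \<longleftrightarrow>
     hybrid_solution C F D G E x \<and>
     \<not> (\<exists>E' y. hybrid_solution C F D G E' y \<and> E \<subset> E' \<and> (\<forall>(t, j)\<in>E. y t j = x t j))"

definition forward_pre_invariant ::
    "'a::euclidean_space set \<Rightarrow> ('a \<Rightarrow> 'a set) \<Rightarrow> 'a set \<Rightarrow> ('a \<Rightarrow> 'a set) \<Rightarrow>
     'a set \<Rightarrow> bool" where
  "forward_pre_invariant C F D G K \<longleftrightarrow>
     K \<subseteq> C \<union> D \<and>
     (\<forall>x\<^sub>o\<in>K. \<forall>E x. maximal_hybrid_solution C F D G E x \<and> x 0 0 = x\<^sub>o \<longrightarrow>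
        (\<forall>(t, j)\<in>E. x t j \<in> K))"

definition barrier_candidate ::
    "(real^'n) set \<Rightarrow> (real^'n) set \<Rightarrow> (real^'n \<Rightarrow> real^'m) \<Rightarrow> (real^'n) set \<Rightarrow> bool" where
  "barrier_candidate C D B K \<longleftrightarrow> K = {x \<in> C \<union> D. B x \<le> 0}"

end

theory Submission
  imports Defs
begin

text \<open>
  If a flow left \<open>K\<close>, then just after the last time at which it is in \<open>K\<close> some component \<open>B\<^sub>i\<close> is
  positive although it vanishes at that last time, which is a point of \<open>M\<^sub>i\<close>. On the interval where
  \<open>B\<^sub>i > 0\<close> the flow stays in \<open>U(M\<^sub>i) \<inter> C\<close> and its velocity is almost everywhere tangent to \<open>C\<close>, so the
  absolutely continuous function \<open>B\<^sub>i \<circ> x\<close> has nonpositive derivative almost everywhere and cannot have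
  grown from zero.
\<close>

section \<open>Absolutely continuous functions\<close>

lemma absolutely_continuous_on_subinterval:
  assumes "absolutely_continuous_on_interval a b f" "a \<le> c" "d \<le> b"
  shows "absolutely_continuous_on_interval c d f"
  unfolding absolutely_continuous_on_interval_def
proof (intro allI impI)
  fix e :: real assume "e > 0"
  then obtain \<delta> where \<delta>: "\<delta> > 0" "\<And>P :: (real \<times> real) set.
        finite P \<and> (\<forall>(u, v)\<in>P. a \<le> u \<and> u \<le> v \<and> v \<le> b) \<and>
        pairwise (\<lambda>p q. {fst p<..<snd p} \<inter> {fst q<..<snd q} = {}) P \<and>
        (\<Sum>(u, v)\<in>P. v - u) < \<delta> \<Longrightarrow>
        (\<Sum>(u, v)\<in>P. norm (f v - f u)) < e"
    using assms(1) unfolding absolutely_continuous_on_interval_def by meson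
  show "\<exists>\<delta>>0. \<forall>P :: (real \<times> real) set.
        finite P \<and> (\<forall>(u, v)\<in>P. c \<le> u \<and> u \<le> v \<and> v \<le> d) \<and>
        pairwise (\<lambda>p q. {fst p<..<snd p} \<inter> {fst q<..<snd q} = {}) P \<and>
        (\<Sum>(u, v)\<in>P. v - u) < \<delta> \<longrightarrow>
        (\<Sum>(u, v)\<in>P. norm (f v - f u)) < e"
    using \<delta>(1)
  proof (intro exI[of _ \<delta>] conjI allI impI)
    fix P :: "(real \<times> real) set"
    assume P: "finite P \<and> (\<forall>(u, v)\<in>P. c \<le> u \<and> u \<le> v \<and> v \<le> d) \<and>
        pairwise (\<lambda>p q. {fst p<..<snd p} \<inter> {fst q<..<snd q} = {}) P \<and>
        (\<Sum>(u, v)\<in>P. v - u) < \<delta>"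
    then have "\<forall>(u, v)\<in>P. a \<le> u \<and> u \<le> v \<and> v \<le> b"
      using assms(2,3) by fastforce
    with P show "(\<Sum>(u, v)\<in>P. norm (f v - f u)) < e"
      by (intro \<delta>(2)) blast
  qed
qed

lemma absolutely_continuous_on_interval_imp_continuous_on:
  assumes "absolutely_continuous_on_interval a b f"
  shows "continuous_on {a..b} f"
  unfolding continuous_on_iff
proof (intro ballI allI impI)
  fix x e :: real assume x: "x \<in> {a..b}" and "e > 0"
  then obtain \<delta> where \<delta>: "\<delta> > 0" "\<And>P :: (real \<times> real) set.
        finite P \<and> (\<forall>(u, v)\<in>P. a \<le> u \<and> u \<le> v \<and> v \<le> b) \<and>
        pairwise (\<lambda>p q. {fst p<..<snd p} \<inter> {fst q<..<snd q} = {}) P \<and>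
        (\<Sum>(u, v)\<in>P. v - u) < \<delta> \<Longrightarrow>
        (\<Sum>(u, v)\<in>P. norm (f v - f u)) < e"
    using assms unfolding absolutely_continuous_on_interval_def by meson
  have "dist (f y) (f x) < e" if y: "y \<in> {a..b}" "dist y x < \<delta>" for y
    using \<delta>(2)[of "{(x, y)}"] \<delta>(2)[of "{(y, x)}"] x y
    by (cases "x \<le> y") (auto simp: dist_norm norm_minus_commute)
  with \<delta>(1) show "\<exists>d>0. \<forall>x'\<in>{a..b}. dist x' x < d \<longrightarrow> dist (f x') (f x) < e"
    by blast
qed

text \<open>The bound on \<open>g\<close> is asked only along the values of \<open>f\<close>: a
  continuously differentiable map need not be Lipschitz globally, but it is on the compact image of
  a path.\<close>

lemma absolutely_continuous_on_interval_lipschitz_compose: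
  assumes f: "absolutely_continuous_on_interval a b f"
    and lip: "\<And>x y. x \<in> {a..b} \<Longrightarrow> y \<in> {a..b} \<Longrightarrow> norm (g (f x) - g (f y)) \<le> L * norm (f x - f y)"
  shows "absolutely_continuous_on_interval a b (\<lambda>t. g (f t))"
  unfolding absolutely_continuous_on_interval_def
proof (intro allI impI)
  fix e :: real assume e: "e > 0"
  \<comment> \<open>\<open>L\<close> may be zero or negative; \<open>L'\<close> is a positive upper
    bound, so that \<open>e / L'\<close> is a legitimate tolerance.\<close>
  define L' where "L' = \<bar>L\<bar> + 1"
  have L': "L' > 0" unfolding L'_def by linarith
  with e have "e / L' > 0" by simp
  then obtain \<delta> where \<delta>: "\<delta> > 0" "\<And>P :: (real \<times> real) set.
        finite P \<and> (\<forall>(u, v)\<in>P. a \<le> u \<and> u \<le> v \<and> v \<le> b) \<and>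
        pairwise (\<lambda>p q. {fst p<..<snd p} \<inter> {fst q<..<snd q} = {}) P \<and>
        (\<Sum>(u, v)\<in>P. v - u) < \<delta> \<Longrightarrow>
        (\<Sum>(u, v)\<in>P. norm (f v - f u)) < e / L'"
    using f unfolding absolutely_continuous_on_interval_def by meson
  show "\<exists>\<delta>>0. \<forall>P :: (real \<times> real) set.
        finite P \<and> (\<forall>(u, v)\<in>P. a \<le> u \<and> u \<le> v \<and> v \<le> b) \<and>
        pairwise (\<lambda>p q. {fst p<..<snd p} \<inter> {fst q<..<snd q} = {}) P \<and>
        (\<Sum>(u, v)\<in>P. v - u) < \<delta> \<longrightarrow>
        (\<Sum>(u, v)\<in>P. norm (g (f v) - g (f u))) < e"
    using \<delta>(1)
  proof (intro exI[of _ \<delta>] conjI allI impI)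
    fix P :: "(real \<times> real) set"
    assume P: "finite P \<and> (\<forall>(u, v)\<in>P. a \<le> u \<and> u \<le> v \<and> v \<le> b) \<and>
        pairwise (\<lambda>p q. {fst p<..<snd p} \<inter> {fst q<..<snd q} = {}) P \<and>
        (\<Sum>(u, v)\<in>P. v - u) < \<delta>"
    have "(\<Sum>(u, v)\<in>P. norm (g (f v) - g (f u))) \<le> (\<Sum>(u, v)\<in>P. L' * norm (f v - f u))"
    proof (rule sum_mono, clarify)
      fix u v assume "(u, v) \<in> P"
      with P have "u \<in> {a..b}" "v \<in> {a..b}" by fastforce+
      then have "norm (g (f v) - g (f u)) \<le> L * norm (f v - f u)"
        by (intro lip)
      also have "\<dots> \<le> L' * norm (f v - f u)"
        unfolding L'_def by (intro mult_right_mono) auto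
      finally show "norm (g (f v) - g (f u)) \<le> L' * norm (f v - f u)" .
    qed
    also have "\<dots> = L' * (\<Sum>(u, v)\<in>P. norm (f v - f u))"
      by (simp add: sum_distrib_left case_prod_unfold)
    also have "\<dots> < L' * (e / L')"
      using L' \<delta>(2)[OF P] by (intro mult_strict_left_mono)
    finally show "(\<Sum>(u, v)\<in>P. norm (g (f v) - g (f u))) < e"
      using L' by simp
  qed
qed

section \<open>Monotonicity from the sign of an almost everywhere derivative\<close>

text \<open>Translates a gauge-theoretic division into the families of endpoint pairs over which
  absolute continuity quantifies; injectivity lets sums over one be rewritten as sums over the
  other.\<close>

lemma tagged_partial_division_endpoints:
  fixes p :: "(real \<times> real set) set"
  assumes p: "p tagged_partial_division_of {a..b}"
  defines "h \<equiv> \<lambda>(x::real, k::real set). (Inf k, Sup k)"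
  shows "inj_on h p"
    and "pairwise (\<lambda>r s. {fst r<..<snd r} \<inter> {fst s<..<snd s} = {}) (h ` p)"
    and "\<forall>(u, v)\<in>h ` p. a \<le> u \<and> u \<le> v \<and> v \<le> b"
proof -
  note D = tagged_partial_division_ofD[OF p]
  have iv: "k = {Inf k..Sup k} \<and> Inf k \<le> x \<and> x \<le> Sup k \<and> a \<le> Inf k \<and> Sup k \<le> b"
    if xk: "(x, k) \<in> p" for x k
  proof -
    obtain u v where k: "k = {u..v}" using D(4)[OF xk] by auto
    moreover have "u \<le> x" "x \<le> v" using D(2)[OF xk] k by auto
    moreover have "a \<le> u" "v \<le> b" using D(3)[OF xk] k calculation by auto
    ultimately show ?thesis by simp
  qed
  show "inj_on h p"
  proof (rule inj_onI)
    fix q q' assume "q \<in> p" "q' \<in> p" and hq: "h q = h q'"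
    then obtain x k x' k' where q: "q = (x, k)" "q' = (x', k')"
      and xk: "(x, k) \<in> p" "(x', k') \<in> p" by (metis surj_pair)
    from hq q have eq: "Inf k = Inf k'" "Sup k = Sup k'" by (auto simp: h_def)
    then have kk: "k = k'" using iv xk by metis
    moreover have "x = x'"
    \<comment> \<open>One interval with two different tags would have interior disjoint from itself,
      hence be a single point, which cannot hold both tags.\<close>
    proof (rule ccontr)
      assume "x \<noteq> x'"
      then have "interior k \<inter> interior k' = {}" using D(5) xk by blast
      then have "{Inf k<..<Sup k} = {}"
        using kk iv[OF xk(1)] by (metis inf.idem interior_atLeastAtMost_real)
      then have "Sup k \<le> Inf k" by simp
      then show False using iv[OF xk(1)] iv[OF xk(2)] eq \<open>x \<noteq> x'\<close> by auto
    qed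
    ultimately show "q = q'" using q by blast
  qed
  show "pairwise (\<lambda>r s. {fst r<..<snd r} \<inter> {fst s<..<snd s} = {}) (h ` p)"
  proof (rule pairwiseI)
    fix r s assume "r \<in> h ` p" "s \<in> h ` p" "r \<noteq> s"
    then obtain x k x' k' where rs: "r = h (x, k)" "s = h (x', k')" "h (x, k) \<noteq> h (x', k')"
      and xk: "(x, k) \<in> p" "(x', k') \<in> p" by (metis imageE surj_pair)
    then have "(x, k) \<noteq> (x', k')" by auto
    then have "interior k \<inter> interior k' = {}" using D(5) xk by blast
    moreover have "interior k = {Inf k<..<Sup k}" "interior k' = {Inf k'<..<Sup k'}"
      using iv xk by (metis interior_atLeastAtMost_real)+
    ultimately show "{fst r<..<snd r} \<inter> {fst s<..<snd s} = {}"
      by (simp add: rs h_def)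
  qed
  show "\<forall>(u, v)\<in>h ` p. a \<le> u \<and> u \<le> v \<and> v \<le> b"
    using iv by (fastforce simp: h_def)
qed

text \<open>Turns a covering open set of small measure into the bound on total length that absolute
  continuity requires.\<close>

lemma sum_disjoint_interval_lengths_le_measure:
  assumes "finite P" "\<forall>(u, v)\<in>P. u \<le> v \<and> {u<..<v} \<subseteq> V"
    and "pairwise (\<lambda>p q. {fst p<..<snd p} \<inter> {fst q<..<snd q} = {}) P"
    and "V \<in> lmeasurable"
  shows "(\<Sum>(u, v)\<in>P. v - u) \<le> measure lebesgue V"
proof -
  let ?f = "\<lambda>p :: real \<times> real. {fst p<..<snd p}"
  have "(\<Sum>(u, v)\<in>P. v - u) = (\<Sum>p\<in>P. measure lebesgue (?f p))"
    using assms(2) by (intro sum.cong) auto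
  also have "\<dots> = measure lebesgue (\<Union>(?f ` P))"
  proof (rule measure_negligible_finite_Union_image[symmetric])
    show "pairwise (\<lambda>x y. negligible (?f x \<inter> ?f y)) P"
      using assms(3) by (simp add: pairwise_def)
  qed (use assms(1) in auto)
  also have "\<dots> \<le> measure lebesgue V"
  proof (rule measure_mono_fmeasurable)
    show "\<Union>(?f ` P) \<subseteq> V" using assms(2) by (auto simp: case_prod_unfold)
    show "\<Union>(?f ` P) \<in> sets lebesgue" using assms(1) by (intro sets.finite_UN) auto
  qed (rule assms(4))
  finally show ?thesis .
qed

text \<open>
  By Cousin's lemma the interval splits into tagged pieces that either satisfy the derivative
  estimate at their tag or lie in an open set of small measure covering the exceptional set.
\<close>
lemma absolutely_continuous_nonincreasing:
  fixes g :: "real \<Rightarrow> real"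
  assumes "a \<le> b" and ac: "absolutely_continuous_on_interval a b g"
    and N: "negligible N"
    and der: "\<And>t. t \<in> {a<..<b} - N \<Longrightarrow> \<exists>d\<le>0. (g has_real_derivative d) (at t)"
  shows "g b \<le> g a"
proof (rule field_le_epsilon)
  fix e0 :: real assume "e0 > 0"
  \<comment> \<open>The pieces tagged in the exceptional set will cost \<open>e\<close> and the
    others \<open>e * (b - a)\<close>, together \<open>e0\<close>.\<close>
  define e where "e = e0 / (b - a + 1)"
  have e: "e > 0" "e * (b - a + 1) = e0"
    using \<open>e0 > 0\<close> \<open>a \<le> b\<close> by (auto simp: e_def)
  obtain \<delta> where \<delta>: "\<delta> > 0" "\<And>P :: (real \<times> real) set.
        finite P \<and> (\<forall>(u, v)\<in>P. a \<le> u \<and> u \<le> v \<and> v \<le> b) \<and>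
        pairwise (\<lambda>p q. {fst p<..<snd p} \<inter> {fst q<..<snd q} = {}) P \<and>
        (\<Sum>(u, v)\<in>P. v - u) < \<delta> \<Longrightarrow>
        (\<Sum>(u, v)\<in>P. norm (g v - g u)) < e"
    using ac e(1) unfolding absolutely_continuous_on_interval_def by meson
  \<comment> \<open>The endpoints join the exceptional set because \<open>der\<close> speaks of the
    open interval only.\<close>
  define Z where "Z = N \<union> {a, b}"
  have Z: "negligible Z" using N unfolding Z_def by (simp add: negligible_Un)
  then obtain V where V: "open V" "Z \<subseteq> V" "V - Z \<in> lmeasurable"
      "emeasure lebesgue (V - Z) < ennreal \<delta>"
    using sets_lebesgue_outer_open[OF negligible_imp_sets \<delta>(1)] by metis
  have Vm: "V \<in> lmeasurable"
    using V(2,3) Z by (metis Diff_partition fmeasurable.Un negligible_imp_measurable)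
  \<comment> \<open>Outer regularity bounds only \<open>V - Z\<close>; as \<open>Z\<close> is null,
    \<open>V\<close> itself is equally small.\<close>
  have "measure lebesgue V = measure lebesgue (V - Z)"
    using Z negligible_imp_sets[OF Z] Vm by (simp add: measure_Diff_null_set negligible_iff_null_sets)
  also have "\<dots> < \<delta>"
    using V(4) V(3) \<delta>(1) by (simp add: emeasure_eq_measure2 ennreal_less_iff)
  finally have V\<delta>: "measure lebesgue V < \<delta>" .
  \<comment> \<open>Since \<open>u\<close> and \<open>v\<close> lie on either side of
    \<open>t\<close>, the two first-order errors add up to exactly \<open>e * (v - u)\<close>, and
    the linear part \<open>d * (v - u)\<close> is nonpositive.\<close>
  have "\<exists>r>0. \<forall>u v. t - r < u \<and> u \<le> t \<and> t \<le> v \<and> v < t + r \<longrightarrow> g v - g u \<le> e * (v - u)"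
    if "t \<in> {a..b} - Z" for t
  proof -
    have "t \<in> {a<..<b} - N" using that by (auto simp: Z_def less_le)
    then obtain d where d: "d \<le> 0" "(g has_real_derivative d) (at t)"
      using der by blast
    then obtain r where r: "r > 0"
        "\<And>s. norm (s - t) < r \<Longrightarrow> norm (g s - g t - d * (s - t)) \<le> e * norm (s - t)"
      using e(1) unfolding has_field_derivative_def has_derivative_at_alt by blast
    have "g v - g u \<le> e * (v - u)" if "t - r < u" "u \<le> t" "t \<le> v" "v < t + r" for u v
    proof -
      have "g v - g t - d * (v - t) \<le> e * (v - t)" "-(g u - g t - d * (u - t)) \<le> e * (t - u)"
        using r(2)[of v] r(2)[of u] that by (simp_all add: abs_le_iff)
      then have "g v - g u \<le> d * (v - u) + e * (v - u)" by (simp add: algebra_simps)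
      moreover have "d * (v - u) \<le> 0" using d(1) that by (intro mult_nonpos_nonneg) auto
      ultimately show ?thesis by linarith
    qed
    with r(1) show ?thesis by blast
  qed
  then obtain r where r: "\<And>t. t \<in> {a..b} - Z \<Longrightarrow> r t > 0"
      "\<And>t u v. t \<in> {a..b} - Z \<Longrightarrow> t - r t < u \<Longrightarrow> u \<le> t \<Longrightarrow> t \<le> v \<Longrightarrow> v < t + r t
        \<Longrightarrow> g v - g u \<le> e * (v - u)"
    by metis
  \<comment> \<open>Pieces with an exceptional tag are forced into \<open>V\<close>, the others into
    the range of the derivative estimate. No tag lies outside \<open>{a..b}\<close>, so
    \<open>UNIV\<close> there only completes the gauge.\<close>
  define \<gamma> where "\<gamma> t = (if t \<in> Z then V else if t \<in> {a..b} then ball t (r t) else UNIV)" for t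
  have "gauge \<gamma>"
    using V(1,2) r(1) by (auto simp: gauge_def \<gamma>_def)
  then obtain p where p: "p tagged_division_of {a..b}" "\<gamma> fine p"
    using fine_division_exists_real by blast
  note D = tagged_division_ofD[OF p(1)]
  have iv: "k = {Inf k..Sup k} \<and> Inf k \<le> x \<and> x \<le> Sup k \<and> x \<in> {a..b} \<and> k \<subseteq> \<gamma> x"
    if xk: "(x, k) \<in> p" for x k
  proof -
    obtain u v where k: "k = {u..v}" using D(4)[OF xk] by auto
    moreover have "u \<le> x" "x \<le> v" using D(2)[OF xk] k by auto
    moreover have "x \<in> {a..b}" using D(2,3)[OF xk] by auto
    ultimately show ?thesis using p(2) xk by (auto simp: fine_def)
  qed
  define p1 where "p1 = {(x, k) \<in> p. x \<in> Z}"
  define p2 where "p2 = {(x, k) \<in> p. x \<notin> Z}"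
  have p12: "p = p1 \<union> p2" "p1 \<inter> p2 = {}" "p1 \<subseteq> p" "p2 \<subseteq> p" "finite p1" "finite p2"
    using D(1) by (auto simp: p1_def p2_def intro: finite_subset[of _ p])
  have "p1 tagged_partial_division_of {a..b}"
    using p(1) p12(3) tagged_partial_division_subset tagged_division_of_def by blast
  note h = tagged_partial_division_endpoints[OF this]
  let ?h = "\<lambda>(x::real, k::real set). (Inf k, Sup k)"
  \<comment> \<open>Exceptional tags: the pieces lie in \<open>V\<close>, so their total length is
    below \<delta> and absolute continuity bounds the growth of \<open>g\<close> over them.\<close>
  have "(\<Sum>(x, k)\<in>p1. g (Sup k) - g (Inf k)) \<le> (\<Sum>(x, k)\<in>p1. norm (g (Sup k) - g (Inf k)))"
    by (intro sum_mono) auto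
  also have "\<dots> = (\<Sum>(u, v)\<in>?h ` p1. norm (g v - g u))"
    by (subst sum.reindex[OF h(1)]) (simp add: case_prod_unfold)
  also have "\<dots> < e"
  proof (intro \<delta>(2) conjI h)
    have "\<forall>(u, v)\<in>?h ` p1. u \<le> v \<and> {u<..<v} \<subseteq> V"
    proof clarify
      fix x k assume "(x, k) \<in> p1"
      then have xk: "(x, k) \<in> p" "x \<in> Z" by (auto simp: p1_def)
      show "Inf k \<le> Sup k \<and> {Inf k<..<Sup k} \<subseteq> V"
        using iv[OF xk(1)] xk(2) greaterThanLessThan_subseteq_atLeastAtMost_iff[of "Inf k" "Sup k" "Inf k" "Sup k"]
        by (auto simp: \<gamma>_def)
    qed
    then show "(\<Sum>(u, v)\<in>?h ` p1. v - u) < \<delta>"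
      using sum_disjoint_interval_lengths_le_measure[OF _ _ h(2) Vm] p12(5) V\<delta> by fastforce
  qed (use p12(5) in auto)
  finally have s1: "(\<Sum>(x, k)\<in>p1. g (Sup k) - g (Inf k)) \<le> e" by simp
  \<comment> \<open>Remaining tags: each piece lies in the ball around its tag, so the derivative
    estimate applies; the lengths sum to at most \<open>b - a\<close>.\<close>
  have "(\<Sum>(x, k)\<in>p2. g (Sup k) - g (Inf k)) \<le> (\<Sum>(x, k)\<in>p2. e * (Sup k - Inf k))"
  proof (rule sum_mono, clarify)
    fix x k assume "(x, k) \<in> p2"
    then have xk: "(x, k) \<in> p" "x \<notin> Z" by (auto simp: p2_def)
    note i = iv[OF xk(1)]
    then have "k \<subseteq> ball x (r x)" using xk(2) by (auto simp: \<gamma>_def split: if_splits)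
    moreover have "Inf k \<in> k" "Sup k \<in> k" using i
      by (metis atLeastAtMost_iff order_refl order_trans)+
    ultimately have "dist x (Inf k) < r x" "dist x (Sup k) < r x" by auto
    then show "g (Sup k) - g (Inf k) \<le> e * (Sup k - Inf k)"
      using i xk(2) by (intro r(2)[of x]) (auto simp: dist_real_def)
  qed
  also have "\<dots> \<le> (\<Sum>(x, k)\<in>p. e * (Sup k - Inf k))"
    using p12 D(1) iv e(1) by (intro sum_mono2) (fastforce intro!: mult_nonneg_nonneg)+
  also have "\<dots> = e * (\<Sum>(x, k)\<in>p. Sup k - Inf k)"
    by (simp add: sum_distrib_left case_prod_unfold)
  also have "\<dots> = e * (b - a)"
    using additive_tagged_division_1[OF \<open>a \<le> b\<close> p(1), of "\<lambda>x. x"] by simp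
  finally have s2: "(\<Sum>(x, k)\<in>p2. g (Sup k) - g (Inf k)) \<le> e * (b - a)" .
  have "g b - g a = (\<Sum>(x, k)\<in>p. g (Sup k) - g (Inf k))"
    using additive_tagged_division_1[OF \<open>a \<le> b\<close> p(1)] by metis
  also have "\<dots> = (\<Sum>(x, k)\<in>p1. g (Sup k) - g (Inf k)) + (\<Sum>(x, k)\<in>p2. g (Sup k) - g (Inf k))"
    using p12 by (simp add: sum.union_disjoint)
  also have "\<dots> \<le> e0" using s1 s2 e(2) by (simp add: algebra_simps)
  finally show "g b \<le> g a + e0" by simp
qed

text \<open>After the last time \<open>s\<close> with \<open>g s \<le> 0\<close> the function is
  positive, so the derivative condition holds almost everywhere there and
  \<open>g b \<le> g s\<close>. Asking for it only where \<open>g t > 0\<close> matches a barrier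
  condition imposed only outside the sublevel set.\<close>

lemma absolutely_continuous_nonpos_invariant:
  fixes g :: "real \<Rightarrow> real"
  assumes "a \<le> b" and ac: "absolutely_continuous_on_interval a b g"
    and N: "negligible N"
    and der: "\<And>t. t \<in> {a<..<b} - N \<Longrightarrow> g t > 0 \<Longrightarrow> \<exists>d\<le>0. (g has_real_derivative d) (at t)"
    and "g a \<le> 0"
  shows "g b \<le> 0"
proof (rule ccontr)
  assume nb: "\<not> g b \<le> 0"
  let ?S = "{a..b} \<inter> g -` {..0}"
  have "closed ?S"
    using absolutely_continuous_on_interval_imp_continuous_on[OF ac]
    by (intro continuous_closed_preimage) auto
  moreover have ne: "?S \<noteq> {}" using assms(1,5) by auto
  moreover have bdd: "bdd_above ?S" by auto
  ultimately have s: "Sup ?S \<in> ?S" by (metis closed_contains_Sup)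
  define s where "s = Sup ?S"
  have pos: "g t > 0" if "s < t" "t \<le> b" for t
  proof (rule ccontr)
    assume "\<not> g t > 0"
    with that s have "t \<in> ?S" unfolding s_def by auto
    then have "t \<le> s" unfolding s_def by (rule cSup_upper[OF _ bdd])
    with that show False by simp
  qed
  have "g b \<le> g s"
  proof (rule absolutely_continuous_nonincreasing[where N = N and g = g and a = s and b = b])
    show "absolutely_continuous_on_interval s b g"
      using ac s unfolding s_def by (auto intro: absolutely_continuous_on_subinterval)
      show "\<exists>d\<le>0. (g has_real_derivative d) (at t)" if "t \<in> {s<..<b} - N" for t
      using that s by (intro der pos) (auto simp: s_def)
  qed (use s N in \<open>auto simp: s_def\<close>)
  with s nb show False unfolding s_def by simp
qed

section \<open>Lipschitz bounds, gradients and tangent directions\<close>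

lemma continuously_differentiable_imp_Lipschitz_on_compact:
  fixes f :: "'a::euclidean_space \<Rightarrow> 'b::real_normed_vector"
  assumes "continuously_differentiable f" "compact S"
  obtains L where "\<And>x y. x \<in> S \<Longrightarrow> y \<in> S \<Longrightarrow> norm (f x - f y) \<le> L * norm (x - y)"
proof -
  obtain f' where f': "\<And>x. (f has_derivative blinfun_apply (f' x)) (at x)" "continuous_on UNIV f'"
    using assms(1) unfolding continuously_differentiable_def by blast
  obtain R where "\<forall>x\<in>S. norm x \<le> R"
    using compact_imp_bounded[OF assms(2)] unfolding bounded_iff by blast
  \<comment> \<open>The mean value inequality needs a convex domain, so \<open>S\<close> is enlarged
    to a ball, still compact, on which the continuous derivative is bounded.\<close>
  then have R: "S \<subseteq> cball 0 R" by auto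
  have "bounded (f' ` cball 0 R)"
    by (intro compact_imp_bounded compact_continuous_image continuous_on_subset[OF f'(2)]) auto
  then obtain L where L: "\<And>x. x \<in> cball 0 R \<Longrightarrow> norm (f' x) \<le> L"
    unfolding bounded_iff by blast
  have "norm (f x - f y) \<le> L * norm (x - y)" if "x \<in> S" "y \<in> S" for x y
  proof (rule differentiable_bound[of "cball 0 R"])
    show "(f has_derivative blinfun_apply (f' z)) (at z within cball 0 R)" for z
      using f'(1) has_derivative_at_withinI by blast
    show "onorm (blinfun_apply (f' z)) \<le> L" if "z \<in> cball 0 R" for z
      using L[OF that] by (simp add: norm_blinfun.rep_eq)
  qed (use that R in auto)
  then show ?thesis using that by blast
qed

text \<open>\<open>gradient\<close> is a definite description, so a representing vector must be
  exhibited and shown unique: it is the one whose coordinates are the values of \<open>f'\<close> on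
  \<open>Basis\<close>.\<close>

lemma gradient_inner_eq_derivative:
  fixes f :: "'a::euclidean_space \<Rightarrow> real"
  assumes "(f has_derivative f') (at x)"
  shows "gradient f x \<bullet> v = f' v"
proof -
  define d where "d = (\<Sum>b\<in>Basis. f' b *\<^sub>R b)"
  have lin: "linear f'" using assms has_derivative_linear by blast
  have d: "f' = (\<lambda>h. h \<bullet> d)"
  proof
    fix h
    have "f' h = f' (\<Sum>b\<in>Basis. (h \<bullet> b) *\<^sub>R b)" by (simp add: euclidean_representation)
    also have "\<dots> = (\<Sum>b\<in>Basis. (h \<bullet> b) * f' b)"
      by (simp add: linear_sum[OF lin] linear_scale[OF lin])
    also have "\<dots> = h \<bullet> d" by (simp add: d_def inner_sum_right mult.commute)
    finally show "f' h = h \<bullet> d" .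
  qed
  have "gradient f x = d"
    unfolding gradient_def
  proof (rule the_equality)
    show "GDERIV f x :> d" using assms d unfolding gderiv_def by simp
    fix d' assume "GDERIV f x :> d'"
    then have "(\<lambda>h. h \<bullet> d') = f'"
      using assms has_derivative_unique unfolding gderiv_def by blast
    then have "h \<bullet> d' = h \<bullet> d" for h using d by metis
    then show "d' = d" using vector_eq_ldot by blast
  qed
  then show ?thesis using d by (simp add: inner_commute)
qed

text \<open>The point \<open>y (t + h)\<close> of \<open>C\<close> differs from
  \<open>y t + h *\<^sub>R v\<close> by the first-order remainder, which is o(h). The distance
  quotient thus has limit 0, and so has its lower limit.\<close>

lemma right_velocity_in_contingent_cone:
  assumes der: "(y has_vector_derivative v) (at t)"
    and ev: "eventually (\<lambda>s. y s \<in> C) (at_right t)"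
  shows "v \<in> contingent_cone C (y t)"
proof -
  let ?q = "\<lambda>h. infdist (y t + h *\<^sub>R v) C / h"
  have lim: "((\<lambda>h. norm (y (t + h) - y t - h *\<^sub>R v) / norm h) \<longlongrightarrow> 0) (at_right 0)"
    using der unfolding has_vector_derivative_def has_derivative_at
    by (blast intro: filterlim_at_split[THEN iffD1, THEN conjunct2])
  have evh: "eventually (\<lambda>h. y (t + h) \<in> C) (at_right 0)"
    using ev by (subst (asm) eventually_at_right_to_0) (simp add: add.commute)
  have "(?q \<longlongrightarrow> 0) (at_right 0)"
  proof (rule tendsto_sandwich[OF _ _ tendsto_const lim])
    show "eventually (\<lambda>h. 0 \<le> ?q h) (at_right 0)"
      using eventually_at_right_less[of 0] by eventually_elim (simp add: infdist_nonneg)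
    show "eventually (\<lambda>h. ?q h \<le> norm (y (t + h) - y t - h *\<^sub>R v) / norm h) (at_right 0)"
      using eventually_at_right_less[of 0] evh
    proof eventually_elim
      case (elim h)
      have "infdist (y t + h *\<^sub>R v) C \<le> dist (y t + h *\<^sub>R v) (y (t + h))"
        using elim by (intro infdist_le) auto
      also have "\<dots> = norm (y (t + h) - y t - h *\<^sub>R v)"
        by (simp add: dist_norm norm_minus_commute algebra_simps)
      finally show ?case using elim by (simp add: divide_right_mono)
    qed
  qed
  then have "((\<lambda>h. ereal (?q h)) \<longlongrightarrow> ereal 0) (at_right 0)" by (intro tendsto_ereal)
  then have "Liminf (at_right 0) (\<lambda>h. ereal (?q h)) = 0"
    by (simp add: lim_imp_Liminf zero_ereal_def[symmetric])
  \<comment> \<open>The cone of the empty set is empty by definition; the nontrivial filter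
    \<open>at_right t\<close> yields an actual point of \<open>C\<close>.\<close>
  moreover have "C \<noteq> {}"
    using eventually_happens[OF ev] by auto
  ultimately show ?thesis unfolding contingent_cone_def by simp
qed

section \<open>Flows and jumps\<close>

text \<open>Flow points are known to be in \<open>C\<close> only at interior times, so membership in
  \<open>K\<close> is proved there first and carried to \<open>b\<close> by closedness of
  \<open>K\<close>.\<close>

lemma flow_preserves_sublevel_set:
  fixes B :: "real^'n \<Rightarrow> real^'m"
  assumes B_C1: "continuously_differentiable B"
    and K: "barrier_candidate C D B K" and K_closed: "closed K"
    and flow: "\<And>i. \<exists>U. open U \<and> {z \<in> frontier K. B z $ i = 0} \<subseteq> U \<and>
      (\<forall>z\<in>(U - {z. B z $ i \<le> 0}) \<inter> C. \<forall>\<eta>\<in>F z \<inter> contingent_cone C z.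
         gradient (\<lambda>z. B z $ i) z \<bullet> \<eta> \<le> 0)"
    and "a \<le> b" and ac: "absolutely_continuous_on_interval a b y"
    and yC: "\<And>t. t \<in> {a<..<b} \<Longrightarrow> y t \<in> C"
    and N: "negligible N"
    and der: "\<And>t. t \<in> {a<..<b} - N \<Longrightarrow> \<exists>v\<in>F (y t). (y has_vector_derivative v) (at t)"
    and "y a \<in> K"
  shows "y b \<in> K"
proof (cases "a = b")
  case True
  with \<open>y a \<in> K\<close> show ?thesis by simp
next
  case False
  with \<open>a \<le> b\<close> have "a < b" by simp
  have cy: "continuous_on {a..b} y"
    by (rule absolutely_continuous_on_interval_imp_continuous_on[OF ac])
  obtain B' where B': "\<And>z. (B has_derivative blinfun_apply (B' z)) (at z)"
    using B_C1 unfolding continuously_differentiable_def by blast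
  have inK: "z \<in> K \<longleftrightarrow> (\<forall>i. B z $ i \<le> 0)" if "z \<in> C" for z
    using K that by (auto simp: barrier_candidate_def less_eq_vec_def)
  have le0: "B z $ i \<le> 0" if "z \<in> K" for z i
    using K that by (auto simp: barrier_candidate_def less_eq_vec_def)
  have inner: "y c \<in> K" if c: "c \<in> {a<..<b}" for c
  proof (rule ccontr)
    assume "y c \<notin> K"
    let ?S = "{a..c} \<inter> y -` K"
    have "closed ?S"
      using c K_closed by (intro continuous_closed_preimage continuous_on_subset[OF cy]) auto
    moreover have "a \<in> ?S" using c \<open>y a \<in> K\<close> by auto
    then have "?S \<noteq> {}" by blast
    moreover have bdd: "bdd_above ?S" by auto
    ultimately have s: "Sup ?S \<in> ?S" by (metis closed_contains_Sup)
    define s where "s = Sup ?S"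
    have s: "a \<le> s" "s < c" "y s \<in> K"
      using s \<open>y c \<notin> K\<close> unfolding s_def by (auto simp: less_le)
    have out: "y t \<notin> K" if "s < t" "t \<le> c" for t
    proof
      assume "y t \<in> K"
      with that s have "t \<in> ?S" by auto
      then have "t \<le> s" unfolding s_def by (rule cSup_upper[OF _ bdd])
      with that show False by simp
    qed
    have lim: "(y \<longlongrightarrow> y s) (at_right s)"
    proof -
      have "(y \<longlongrightarrow> y s) (at s within {s..b})"
        using continuous_on_subset[OF cy, of "{s..b}"] s c by (auto simp: continuous_on_def)
      then show ?thesis using s c by (simp add: at_within_Icc_at_right)
    qed
    have evs: "eventually (\<lambda>t. s < t \<and> t < c) (at_right s)"
      using s(2) by (intro eventually_conj eventually_at_right_less eventually_at_right_real[THEN eventually_mono]) auto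
    \<comment> \<open>\<open>y s\<close> is in \<open>K\<close> and is a limit of points
      \<open>y t\<close> outside \<open>K\<close>.\<close>
    have fr: "y s \<in> frontier K"
    proof -
      have "eventually (\<lambda>t. y t \<in> closure (- K)) (at_right s)"
        using evs
      proof eventually_elim
        case (elim t)
        then have "y t \<in> - K" using out by simp
        then show ?case using closure_subset by blast
      qed
      then have "y s \<in> closure (- K)"
        using lim by (rule Lim_in_closed_set[OF closed_closure _ trivial_limit_at_right_real])
      then show ?thesis using s(3) by (auto simp: frontier_closures closure_def)
    qed
    \<comment> \<open>Neighborhoods are fixed for all components at once, since the violated one is
      identified only later.\<close>
    define U where "U i = (SOME U. open U \<and> {z \<in> frontier K. B z $ i = 0} \<subseteq> U \<and>
      (\<forall>z\<in>(U - {z. B z $ i \<le> 0}) \<inter> C. \<forall>\<eta>\<in>F z \<inter> contingent_cone C z.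
         gradient (\<lambda>z. B z $ i) z \<bullet> \<eta> \<le> 0))" for i
    note U' = someI_ex[OF flow, folded U_def]
    have U: "\<And>i. open (U i)" "\<And>i. {z \<in> frontier K. B z $ i = 0} \<subseteq> U i"
      "\<And>i z \<eta>. z \<in> (U i - {z. B z $ i \<le> 0}) \<inter> C \<Longrightarrow> \<eta> \<in> F z \<inter> contingent_cone C z \<Longrightarrow>
         gradient (\<lambda>z. B z $ i) z \<bullet> \<eta> \<le> 0"
      using U' by simp_all
    \<comment> \<open>A component negative at \<open>s\<close> stays negative for a while; one that
      vanishes at \<open>s\<close> puts \<open>y s\<close> in \<open>M\<^sub>i\<close>, so the flow
      stays in \<open>U i\<close> for a while. Finiteness of the index type then gives one common
      \<open>r\<close>.\<close>
    have "eventually (\<lambda>t. B (y t) $ i < 0 \<or> B (y s) $ i = 0 \<and> y t \<in> U i) (at_right s)" for i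
    proof (cases "B (y s) $ i = 0")
      case True
      then have "y s \<in> U i" using U(2) fr by blast
      with topological_tendstoD[OF lim U(1)] have "eventually (\<lambda>t. y t \<in> U i) (at_right s)" by blast
      then show ?thesis using True by (auto elim: eventually_mono)
    next
      case False
      have "isCont B (y s)" using B' has_derivative_continuous by blast
      then have "((\<lambda>t. B (y t) $ i) \<longlongrightarrow> B (y s) $ i) (at_right s)"
        by (intro tendsto_vec_nth isCont_tendsto_compose[OF _ lim])
      moreover have "B (y s) $ i < 0" using le0[OF s(3), of i] False by simp
      ultimately have "eventually (\<lambda>t. B (y t) $ i < 0) (at_right s)"
        by (rule order_tendstoD(2))
      then show ?thesis by (auto elim: eventually_mono)
    qed
    then have "eventually (\<lambda>t. \<forall>i. B (y t) $ i < 0 \<or> B (y s) $ i = 0 \<and> y t \<in> U i) (at_right s)"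
      by (simp add: eventually_all_finite)
    then obtain r where r: "r > s"
      "\<And>t i. s < t \<Longrightarrow> t < r \<Longrightarrow> B (y t) $ i < 0 \<or> B (y s) $ i = 0 \<and> y t \<in> U i"
      unfolding eventually_at_right_field by blast
    obtain d where d: "s < d" "d < r" "d < c"
      using dense[of s "min r c"] r(1) s(2) by auto
    then have "y d \<in> C" "y d \<notin> K" using yC[of d] out[of d] s c by auto
    then obtain i where "\<not> B (y d) $ i \<le> 0" using inK by blast
    then have i: "B (y d) $ i > 0" by simp
    \<comment> \<open>Positivity at \<open>d\<close> excludes the first alternative of the
      dichotomy, so this component starts from zero at \<open>s\<close>.\<close>
    have B0: "B (y s) $ i = 0" using r(2)[of d i] d i by auto
    let ?g = "\<lambda>t. B (y t) $ i"
    have acsd: "absolutely_continuous_on_interval s d y"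
      using absolutely_continuous_on_subinterval[OF ac] s d c by auto
    have "?g d \<le> 0"
    proof (rule absolutely_continuous_nonpos_invariant[where N = N and g = ?g and a = s and b = d])
      have "compact (y ` {s..d})"
        using s d c by (intro compact_continuous_image continuous_on_subset[OF cy]) auto
      then obtain L where L: "\<And>w z. w \<in> y ` {s..d} \<Longrightarrow> z \<in> y ` {s..d} \<Longrightarrow>
          norm (B w - B z) \<le> L * norm (w - z)"
        using continuously_differentiable_imp_Lipschitz_on_compact[OF B_C1] by metis
      show "absolutely_continuous_on_interval s d ?g"
      proof (rule absolutely_continuous_on_interval_lipschitz_compose[OF acsd, where L = L])
        fix t u assume "t \<in> {s..d}" "u \<in> {s..d}"
        then have "norm (B (y t) - B (y u)) \<le> L * norm (y t - y u)" by (intro L) auto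
        moreover have "norm (B (y t) $ i - B (y u) $ i) \<le> norm (B (y t) - B (y u))"
          using component_le_norm_cart[of "B (y t) - B (y u)" i] by simp
        ultimately show "norm (B (y t) $ i - B (y u) $ i) \<le> L * norm (y t - y u)" by linarith
      qed
    next
      fix t assume t: "t \<in> {s<..<d} - N" and pos: "B (y t) $ i > 0"
      then have tab: "t \<in> {a<..<b} - N" using s d c by auto
      obtain v where v: "v \<in> F (y t)" "(y has_vector_derivative v) (at t)"
        using der[OF tab] by blast
      \<comment> \<open>Times just after \<open>t\<close> are still interior, so the flow remains in
        \<open>C\<close> and its velocity is tangent to \<open>C\<close>.\<close>
      have "eventually (\<lambda>u. u \<in> {t<..<b}) (at_right t)"
        using tab by (intro eventually_at_right_real) auto
      then have "eventually (\<lambda>u. y u \<in> C) (at_right t)"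
        using tab by (auto elim!: eventually_mono intro!: yC)
      then have cone: "v \<in> contingent_cone C (y t)"
        by (rule right_velocity_in_contingent_cone[OF v(2)])
      have "y t \<in> U i" using r(2)[of t i] t d pos by auto
      then have "gradient (\<lambda>z. B z $ i) (y t) \<bullet> v \<le> 0"
        using pos cone v(1) yC tab by (intro U(3)) auto
      moreover have Bi: "((\<lambda>z. B z $ i) has_derivative (\<lambda>h. blinfun_apply (B' (y t)) h $ i)) (at (y t))"
        by (rule bounded_linear.has_derivative[OF bounded_linear_vec_nth B'])
      ultimately have "blinfun_apply (B' (y t)) v $ i \<le> 0"
        by (simp add: gradient_inner_eq_derivative)
      moreover have "(?g has_derivative (\<lambda>h. blinfun_apply (B' (y t)) (h *\<^sub>R v) $ i)) (at t)"
        using has_derivative_compose[OF v(2)[unfolded has_vector_derivative_def] Bi] .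
      then have "(?g has_real_derivative (blinfun_apply (B' (y t)) v $ i)) (at t)"
        by (simp add: has_field_derivative_def blinfun.scaleR_right mult_commute_abs)
      ultimately show "\<exists>d\<le>0. (?g has_real_derivative d) (at t)" by blast
    qed (use d B0 N in auto)
    with i show False by simp
  qed
  \<comment> \<open>The endpoint \<open>b\<close> is reached as a limit of interior times, at which
    the flow is in the closed set \<open>K\<close>.\<close>
  have "(y \<longlongrightarrow> y b) (at_left b)"
  proof -
    have "(y \<longlongrightarrow> y b) (at b within {a..b})"
      using cy \<open>a < b\<close> by (auto simp: continuous_on_def)
    then show ?thesis using \<open>a < b\<close> by (simp add: at_within_Icc_at_left)
  qed
  moreover have "eventually (\<lambda>t. t \<in> {a<..<b}) (at_left b)"
    using \<open>a < b\<close> by (rule eventually_at_left_real)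
  then have "eventually (\<lambda>t. y t \<in> K) (at_left b)"
    by (auto elim!: eventually_mono intro: inner)
  ultimately show ?thesis
    using Lim_in_closed_set[OF K_closed] trivial_limit_at_left_real by metis
qed

section \<open>Hybrid time domains and the flow pieces of a solution\<close>

lemma hybrid_time_domainE:
  assumes "hybrid_time_domain E" "(T, J) \<in> E"
  obtains t :: "nat \<Rightarrow> real" where "\<forall>i\<le>J. t i \<le> t (Suc i)"
    "E \<inter> ({0..T} \<times> {0..J}) = (\<Union>i\<in>{0..J}. {t i..t (Suc i)} \<times> {i})"
proof -
  have "\<exists>t :: nat \<Rightarrow> real. t 0 = 0 \<and> (\<forall>j\<le>J. t j \<le> t (Suc j)) \<and>
      E \<inter> ({0..T} \<times> {0..J}) = (\<Union>j\<in>{0..J}. {t j..t (Suc j)} \<times> {j})"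
    using bspec[OF conjunct2[OF assms(1)[unfolded hybrid_time_domain_def]] assms(2)]
    unfolding prod.case .
  then show ?thesis by (elim exE conjE) (rule that, simp_all only:)
qed

text \<open>In the truncation at \<open>(T, j)\<close>, level \<open>j\<close> is the single segment
  from \<open>t j\<close> to \<open>t (Suc j)\<close>; it contains \<open>S\<close> and
  \<open>T\<close>, hence all times between them.\<close>

lemma hybrid_time_domain_interval:
  assumes "hybrid_time_domain E" "(S, j) \<in> E" "(T, j) \<in> E"
  shows "{S..T} \<subseteq> flow_times E j"
proof -
  obtain t :: "nat \<Rightarrow> real" where "\<forall>i\<le>j. t i \<le> t (Suc i)"
    and t: "E \<inter> ({0..T} \<times> {0..j}) = (\<Union>i\<in>{0..j}. {t i..t (Suc i)} \<times> {i})"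
    by (rule hybrid_time_domainE[OF assms(1,3)])
  have pos: "0 \<le> S" "0 \<le> T" using assms unfolding hybrid_time_domain_def by auto
  show ?thesis
  proof
    fix u assume u: "u \<in> {S..T}"
    have "(S, j) \<in> E \<inter> ({0..T} \<times> {0..j})" "(T, j) \<in> E \<inter> ({0..T} \<times> {0..j})"
      using assms pos u by auto
    then have "t j \<le> S" "T \<le> t (Suc j)" unfolding t by auto
    then have "(u, j) \<in> (\<Union>i\<in>{0..j}. {t i..t (Suc i)} \<times> {i})" using u by auto
    then have "(u, j) \<in> E" using t by blast
    then show "u \<in> flow_times E j" by (simp add: flow_times_def)
  qed
qed

text \<open>The segments of levels \<open>j\<close> and \<open>Suc j\<close> share the point
  \<open>t (Suc j)\<close>, which serves as the jump time \<open>S\<close>.\<close>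

lemma hybrid_time_domain_jump:
  assumes "hybrid_time_domain E" "(T, Suc j) \<in> E"
  obtains S where "S \<le> T" "(S, j) \<in> E" "(S, Suc j) \<in> E"
proof -
  obtain t :: "nat \<Rightarrow> real" where
    t: "\<forall>i\<le>Suc j. t i \<le> t (Suc i)"
       "E \<inter> ({0..T} \<times> {0..Suc j}) = (\<Union>i\<in>{0..Suc j}. {t i..t (Suc i)} \<times> {i})"
    by (rule hybrid_time_domainE[OF assms])
  have "0 \<le> T" using assms unfolding hybrid_time_domain_def by auto
  then have "(T, Suc j) \<in> (\<Union>i\<in>{0..Suc j}. {t i..t (Suc i)} \<times> {i})"
    using assms(2) t(2) by (metis IntI SigmaI atLeastAtMost_iff le0 order_refl)
  then have "t (Suc j) \<le> T" by auto
  moreover have "(t (Suc j), i) \<in> E" if "i = j \<or> i = Suc j" for i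
  proof -
    have "(t (Suc j), i) \<in> (\<Union>i\<in>{0..Suc j}. {t i..t (Suc i)} \<times> {i})"
      using that t(1) by auto
    then show ?thesis using t(2) by blast
  qed
  ultimately show ?thesis using that by blast
qed

text \<open>Puts a solution in the form that \<open>flow_preserves_sublevel_set\<close> expects: a
  null set in place of \<open>AE\<close>, and two-sided derivatives in place of derivatives within
  \<open>flow_times E j\<close>, which agree at interior times.\<close>

lemma hybrid_solution_flow:
  assumes sol: "hybrid_solution C F D G E x" and E: "(S, j) \<in> E" "(T, j) \<in> E"
  obtains N where "absolutely_continuous_on_interval S T (\<lambda>t. x t j)"
    and "\<And>t. t \<in> {S<..<T} \<Longrightarrow> x t j \<in> C" and "negligible N"
    and "\<And>t. t \<in> {S<..<T} - N \<Longrightarrow>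
      \<exists>v\<in>F (x t j). ((\<lambda>s. x s j) has_vector_derivative v) (at t)"
proof (cases "S < T")
  case True
  have sub: "{S..T} \<subseteq> flow_times E j"
    using sol E hybrid_time_domain_interval unfolding hybrid_solution_def by blast
  then have int: "{S<..<T} \<subseteq> interior (flow_times E j)"
    by (metis interior_atLeastAtMost_real interior_mono)
  with True have ne: "interior (flow_times E j) \<noteq> {}" by force
  have 1: "absolutely_continuous_on_interval S T (\<lambda>t. x t j)"
    using sol sub True unfolding hybrid_solution_def locally_absolutely_continuous_on_def by simp
  have 2: "\<And>t. t \<in> {S<..<T} \<Longrightarrow> x t j \<in> C"
    using sol ne int unfolding hybrid_solution_def by blast
  have "AE t in lebesgue. t \<in> flow_times E j \<longrightarrow> (\<exists>v\<in>F (x t j).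
      ((\<lambda>s. x s j) has_vector_derivative v) (at t within flow_times E j))"
    using sol ne unfolding hybrid_solution_def by blast
  then obtain N where N: "N \<in> null_sets lebesgue"
    "\<And>t. t \<notin> N \<Longrightarrow> t \<in> flow_times E j \<Longrightarrow> \<exists>v\<in>F (x t j).
      ((\<lambda>s. x s j) has_vector_derivative v) (at t within flow_times E j)"
    unfolding eventually_ae_filter by (simp add: subset_iff) metis
  have "\<exists>v\<in>F (x t j). ((\<lambda>s. x s j) has_vector_derivative v) (at t)" if "t \<in> {S<..<T} - N" for t
  proof -
    have "t \<in> interior (flow_times E j)" using that int by blast
    then show ?thesis
      using N(2)[of t] that at_within_interior[of t "flow_times E j"] interior_subset by force
  qed
  with 1 2 N(1) that show ?thesis by (metis negligible_iff_null_sets)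
next
  \<comment> \<open>The open interval is empty here; only absolute continuity remains, obtained on
    the one-point interval at \<open>S\<close> and restricted.\<close>
  case False
  have "absolutely_continuous_on_interval S S (\<lambda>t. x t j)"
    using sol E unfolding hybrid_solution_def locally_absolutely_continuous_on_def flow_times_def
    by force
  with False that[of "{}"] show ?thesis
    using absolutely_continuous_on_subinterval[of S S _ S T] by force
qed

theorem theorem1:
  fixes C D K :: "(real^'n) set"
    and F G :: "real^'n \<Rightarrow> (real^'n) set"
    and B :: "real^'n \<Rightarrow> real^'m"
    and Ke M :: "'m \<Rightarrow> (real^'n) set"
  assumes F_osc: "outer_semicontinuous F"
    and F_bounded: "locally_bounded_map F"
    and F_nonempty: "\<And>x. F x \<noteq> {}"
    and F_convex: "\<And>x. convex (F x)"
    and G_nonempty: "\<And>x. x \<in> D \<Longrightarrow> G x \<noteq> {}"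
    and B_C1: "continuously_differentiable B"
    and B_K: "barrier_candidate C D B K"
    and K_closed: "closed K"
    and Ke_eq: "\<And>i. Ke i = {x. B x $ i \<le> 0}"
    and M_eq: "\<And>i. M i = {x \<in> frontier K. B x $ i = 0}"
    and flow: "\<And>i. \<exists>U. open U \<and> M i \<subseteq> U \<and>
      (\<forall>x\<in>(U - Ke i) \<inter> C. \<forall>\<eta>\<in>F x \<inter> contingent_cone C x.
         gradient (\<lambda>z. B z $ i) x \<bullet> \<eta> \<le> 0)"
    and jump: "\<And>x \<eta>. x \<in> D \<inter> K \<Longrightarrow> \<eta> \<in> G x \<Longrightarrow> B \<eta> \<le> 0"
    and jump_dom: "\<And>x. x \<in> D \<inter> K \<Longrightarrow> G x \<subseteq> C \<union> D"
  shows "forward_pre_invariant C F D G K"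
proof -
  have "x T j \<in> K" if sol: "hybrid_solution C F D G E x" and x0: "x 0 0 \<in> K" and "(T, j) \<in> E"
    for E x T j
  proof -
    have dom: "hybrid_time_domain E" using sol by (simp add: hybrid_solution_def)
    have flow_K: "x b j \<in> K" if ab: "a \<le> b" "(a, j) \<in> E" "(b, j) \<in> E" "x a j \<in> K" for a b j
    proof -
      obtain N where N: "absolutely_continuous_on_interval a b (\<lambda>t. x t j)"
        "\<And>t. t \<in> {a<..<b} \<Longrightarrow> x t j \<in> C" "negligible N"
        "\<And>t. t \<in> {a<..<b} - N \<Longrightarrow> \<exists>v\<in>F (x t j). ((\<lambda>s. x s j) has_vector_derivative v) (at t)"
        using hybrid_solution_flow[OF sol ab(2,3)] by blast
      show ?thesis
        by (rule flow_preserves_sublevel_set[OF B_C1 B_K K_closed flow[unfolded M_eq Ke_eq]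
              ab(1) N ab(4)])
    qed
    \<comment> \<open>Induction on the number of jumps, with \<open>T\<close> arbitrary because the
      hypothesis is used at the jump time \<open>S\<close>.\<close>
    show ?thesis
      using \<open>(T, j) \<in> E\<close>
    proof (induction j arbitrary: T)
      case 0
      then have "0 \<le> T" using dom by (auto simp: hybrid_time_domain_def)
      with 0 show ?case using flow_K[of 0 T 0] sol x0 by (simp add: hybrid_solution_def)
    next
      case (Suc j)
      obtain S where S: "S \<le> T" "(S, j) \<in> E" "(S, Suc j) \<in> E"
        using hybrid_time_domain_jump[OF dom Suc.prems] by blast
      have DK: "x S j \<in> D \<inter> K" and G: "x S (Suc j) \<in> G (x S j)"
        using Suc.IH[OF S(2)] S sol by (auto simp: hybrid_solution_def)
      \<comment> \<open>\<open>jump\<close> supplies the sign of \<open>B\<close> and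
        \<open>jump_dom\<close> the membership in \<open>C \<union> D\<close>; flowing from
        \<open>S\<close> to \<open>T\<close> then completes the step.\<close>
      have "x S (Suc j) \<in> K"
        using jump[OF DK G] jump_dom[OF DK] G B_K by (auto simp: barrier_candidate_def)
      then show ?case using flow_K S Suc.prems by blast
    qed
  qed
  moreover have "K \<subseteq> C \<union> D" using B_K by (auto simp: barrier_candidate_def)
  ultimately show ?thesis
    unfolding forward_pre_invariant_def maximal_hybrid_solution_def by blast
qed

end
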